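(* Let $D$ be a skew field, $\sigma$ a ring automorphism of $D$, $\delta$ a $\sigma$-derivation of $D$, and $R = D[X;\sigma,\delta]$. Assume that $R$ is generated, as a module over its center, by finitely many polynomials $c_1,\dots,c_r\in R$. Let $f\in R$ be a nonzero polynomial, and for each $i$ let $f_{c_i}\in R$ be such that $R f_{c_i} = \operatorname{Ann}_R(c_i+Rf)$. Then a bound of $f$ is $$f^* = [f,f_{c_1},\dots,f_{c_r}]_\ell ,$$ the left least common multiple of $f,f_{c_1},\dots,f_{c_r}$.
   Context: A $\sigma$-derivation is an additive map $\delta:D\to D$ with $\delta(ab)=\sigma(a)\delta(b)+\delta(a)b$. $R=D[X;\sigma,\delta]$ is the Ore polynomial ring: a left $D$-vector space with basis $\{X^n: n\ge 0\}$, with $Xa=\sigma(a)X+\delta(a)$ for $a\in D$. It is a left and right principal ideal domain. For a left $R$-module $M$ and $S\subseteq M$, $\operatorname{Ann}_R(S)=\{g\in R: gm=0\ \forall m\in S\}$; $c+Rf$ denotes the class of $c$ in the left module $R/Rf$, and $\operatorname{Ann}_R(c+Rf)$ is the annihilator of that single element. A polynomial $\alpha$ is twosided if $R\alpha=\alpha R$. A bound of $f\in R$ is a twosided polynomial $f^*$ such that $Rf^*=f^*R$ is the largest twosided ideal contained in $Rf$; equivalently $Rf^*=\operatorname{Ann}_R(R/Rf)$. It is determined up to left multiplication by nonzero elements of $D$. The left least common multiple $[g_1,\dots,g_k]_\ell$ is a generator of the left ideal $Rg_1\cap\dots\cap Rg_k$ (determined up to left multiplication by nonzero elements of $D$). 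*)

theory Defs
  imports
    "HOL-Computational_Algebra.Polynomial"
    "HOL-Algebra.Ideal"
    "HOL-Algebra.Module"
begin

section \<open>Ore polynomial rings\<close>

definition ring_automorphism :: "('a::ring_1 \<Rightarrow> 'a) \<Rightarrow> bool" where
  "ring_automorphism \<sigma> \<longleftrightarrow> bij \<sigma> \<and> \<sigma> 1 = 1 \<and>
     (\<forall>a b. \<sigma> (a + b) = \<sigma> a + \<sigma> b) \<and> (\<forall>a b. \<sigma> (a * b) = \<sigma> a * \<sigma> b)"

definition skew_derivation :: "('a::ring_1 \<Rightarrow> 'a) \<Rightarrow> ('a \<Rightarrow> 'a) \<Rightarrow> bool" where
  "skew_derivation \<sigma> \<delta> \<longleftrightarrow>
     (\<forall>a b. \<delta> (a + b) = \<delta> a + \<delta> b) \<and> (\<forall>a b. \<delta> (a * b) = \<sigma> a * \<delta> b + \<delta> a * b)"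

text \<open>
  Type \<^typ>\<open>'a poly\<close> serves only as the additive group of finitely supported coefficient
  sequences: \<^term>\<open>p\<close> stands for the sum of the \<^term>\<open>coeff p i\<close> times \<open>X\<^sup>i\<close>, with coefficients
  on the left. The commutative product of the library is not used (it is not even available for a
  noncommutative coefficient type).

  Left multiplication by \<open>a \<in> D\<close> acts on each coefficient, and the rule
  \<open>X b = \<sigma>(b) X + \<delta>(b)\<close> forces left multiplication by \<open>X\<close> to send the sum of the \<open>b\<^sub>i X\<^sup>i\<close> to
  the sum of the \<open>\<sigma>(b\<^sub>i) X\<^bsup>i+1\<^esup> + \<delta>(b\<^sub>i) X\<^sup>i\<close>.
\<close>

definition scal_mult :: "'a::division_ring \<Rightarrow> 'a poly \<Rightarrow> 'a poly" where
  "scal_mult a q = map_poly (\<lambda>b. a * b) q"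

definition X_mult :: "('a \<Rightarrow> 'a) \<Rightarrow> ('a \<Rightarrow> 'a) \<Rightarrow> 'a::division_ring poly \<Rightarrow> 'a poly" where
  "X_mult \<sigma> \<delta> q = pCons 0 (map_poly \<sigma> q) + map_poly \<delta> q"

definition ore_mult ::
  "('a \<Rightarrow> 'a) \<Rightarrow> ('a \<Rightarrow> 'a) \<Rightarrow> 'a::division_ring poly \<Rightarrow> 'a poly \<Rightarrow> 'a poly" where
  "ore_mult \<sigma> \<delta> p q = (\<Sum>i\<le>degree p. scal_mult (coeff p i) ((X_mult \<sigma> \<delta> ^^ i) q))"

definition ore_ring :: "('a \<Rightarrow> 'a) \<Rightarrow> ('a \<Rightarrow> 'a) \<Rightarrow> 'a::division_ring poly ring" where
  "ore_ring \<sigma> \<delta> =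
     \<lparr>carrier = UNIV, mult = ore_mult \<sigma> \<delta>, one = [:1:], zero = 0, add = (+)\<rparr>"

lemma ore_ring_simps [simp]:
  "carrier (ore_ring \<sigma> \<delta>) = UNIV"
  "mult (ore_ring \<sigma> \<delta>) = ore_mult \<sigma> \<delta>"
  "one (ore_ring \<sigma> \<delta>) = [:1:]"
  "zero (ore_ring \<sigma> \<delta>) = 0"
  "add (ore_ring \<sigma> \<delta>) = (+)"
  by (simp_all add: ore_ring_def)


subsection \<open>The construction yields a ring satisfying the Ore commutation rule\<close>

context
  fixes \<sigma> \<delta> :: "'a::division_ring \<Rightarrow> 'a"
  assumes \<sigma>: "ring_automorphism \<sigma>" and \<delta>: "skew_derivation \<sigma> \<delta>"
begin

private lemma \<sigma>_add: "\<sigma> (a + b) = \<sigma> a + \<sigma> b" and \<sigma>_mult: "\<sigma> (a * b) = \<sigma> a * \<sigma> b"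
  and \<sigma>_one: "\<sigma> 1 = 1"
  using \<sigma> by (simp_all add: ring_automorphism_def)

private lemma \<sigma>_zero: "\<sigma> 0 = 0"
  using \<sigma>_add[of 0 0] by simp

private lemma \<delta>_add: "\<delta> (a + b) = \<delta> a + \<delta> b"
  and \<delta>_mult: "\<delta> (a * b) = \<sigma> a * \<delta> b + \<delta> a * b"
  using \<delta> by (simp_all add: skew_derivation_def)

private lemma \<delta>_zero: "\<delta> 0 = 0"
  using \<delta>_add[of 0 0] by simp

private lemma \<delta>_one: "\<delta> 1 = 0"
  using \<delta>_mult[of 1 1] by (simp add: \<sigma>_one)

private lemma coeff_scal_mult: "coeff (scal_mult a q) n = a * coeff q n"
  by (simp add: scal_mult_def coeff_map_poly)

private lemma coeff_X_mult: "coeff (X_mult \<sigma> \<delta> q) n =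
    (case n of 0 \<Rightarrow> 0 | Suc m \<Rightarrow> \<sigma> (coeff q m)) + \<delta> (coeff q n)"
  by (simp add: X_mult_def coeff_map_poly \<sigma>_zero \<delta>_zero coeff_pCons split: nat.split)

private lemma scal_add: "scal_mult a (p + q) = scal_mult a p + scal_mult a q"
  by (rule poly_eqI) (simp add: coeff_scal_mult distrib_left)

private lemma scal_add_left: "scal_mult (a + b) q = scal_mult a q + scal_mult b q"
  by (rule poly_eqI) (simp add: coeff_scal_mult distrib_right)

private lemma scal_0: "scal_mult 0 q = 0" "scal_mult a 0 = 0"
  by (rule poly_eqI, simp add: coeff_scal_mult)+

private lemma scal_scal: "scal_mult a (scal_mult b q) = scal_mult (a * b) q"
  by (rule poly_eqI) (simp add: coeff_scal_mult mult.assoc)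

private lemma scal_sum: "scal_mult a (sum g A) = (\<Sum>i\<in>A. scal_mult a (g i))"
  by (rule poly_eqI) (simp add: coeff_scal_mult coeff_sum sum_distrib_left)

private lemma X_add: "X_mult \<sigma> \<delta> (p + q) = X_mult \<sigma> \<delta> p + X_mult \<sigma> \<delta> q"
  by (rule poly_eqI) (simp add: coeff_X_mult \<sigma>_add \<delta>_add split: nat.split)

private lemma X_0: "X_mult \<sigma> \<delta> 0 = 0"
  by (rule poly_eqI) (simp add: coeff_X_mult \<sigma>_zero \<delta>_zero split: nat.split)

private lemma X_scal: "X_mult \<sigma> \<delta> (scal_mult a q) =
    scal_mult (\<sigma> a) (X_mult \<sigma> \<delta> q) + scal_mult (\<delta> a) q"
  by (rule poly_eqI)
    (simp add: coeff_X_mult coeff_scal_mult \<sigma>_mult \<delta>_mult distrib_left add.assoc split: nat.split)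

private lemma X_sum: "X_mult \<sigma> \<delta> (sum g A) = (\<Sum>i\<in>A. X_mult \<sigma> \<delta> (g i))"
  by (induction A rule: infinite_finite_induct) (simp_all add: X_0 X_add)

private lemma X_pow_add: "(X_mult \<sigma> \<delta> ^^ i) (p + q) = (X_mult \<sigma> \<delta> ^^ i) p + (X_mult \<sigma> \<delta> ^^ i) q"
  by (induction i) (simp_all add: X_add)

private lemma X_pow_one: "(X_mult \<sigma> \<delta> ^^ i) [:1:] = monom 1 i"
  by (induction i)
    (auto intro!: poly_eqI
      simp: coeff_X_mult \<sigma>_zero \<delta>_zero \<sigma>_one \<delta>_one coeff_pCons split: nat.split)

private lemma ore_mult_upto:
  assumes "degree p \<le> N"
  shows "ore_mult \<sigma> \<delta> p q = (\<Sum>i\<le>N. scal_mult (coeff p i) ((X_mult \<sigma> \<delta> ^^ i) q))"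
  unfolding ore_mult_def using assms
  by (intro sum.mono_neutral_left) (auto simp: coeff_eq_0 scal_0)

private lemma ore_add_left: "ore_mult \<sigma> \<delta> (p + q) r = ore_mult \<sigma> \<delta> p r + ore_mult \<sigma> \<delta> q r"
proof -
  define N where "N = max (degree p) (degree q)"
  have "degree (p + q) \<le> N" "degree p \<le> N" "degree q \<le> N"
    using degree_add_le_max[of p q] by (auto simp: N_def)
  then show ?thesis
    by (simp add: ore_mult_upto scal_add_left sum.distrib)
qed

private lemma ore_add_right: "ore_mult \<sigma> \<delta> p (q + r) = ore_mult \<sigma> \<delta> p q + ore_mult \<sigma> \<delta> p r"
  by (simp add: ore_mult_def X_pow_add scal_add sum.distrib)

private lemma ore_0_left: "ore_mult \<sigma> \<delta> 0 r = 0"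
  by (simp add: ore_mult_def scal_0)

private lemma ore_sum_left: "ore_mult \<sigma> \<delta> (sum g A) r = (\<Sum>i\<in>A. ore_mult \<sigma> \<delta> (g i) r)"
  by (induction A rule: infinite_finite_induct) (simp_all add: ore_0_left ore_add_left)

private lemma ore_scal: "ore_mult \<sigma> \<delta> (scal_mult a q) r = scal_mult a (ore_mult \<sigma> \<delta> q r)"
proof -
  have "degree (scal_mult a q) \<le> degree q"
    by (rule degree_le) (simp add: coeff_scal_mult coeff_eq_0)
  then show ?thesis
    by (simp add: ore_mult_upto[of _ "degree q"] coeff_scal_mult scal_scal scal_sum)
qed

private lemma ore_X: "ore_mult \<sigma> \<delta> (X_mult \<sigma> \<delta> q) r = X_mult \<sigma> \<delta> (ore_mult \<sigma> \<delta> q r)"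
proof -
  define N where "N = degree q"
  let ?T = "\<lambda>i. (X_mult \<sigma> \<delta> ^^ i) r"
  have "degree (X_mult \<sigma> \<delta> q) \<le> Suc N"
    by (rule degree_le) (auto simp: N_def coeff_X_mult coeff_eq_0 \<sigma>_zero \<delta>_zero split: nat.split)
  then have "ore_mult \<sigma> \<delta> (X_mult \<sigma> \<delta> q) r
      = (\<Sum>i\<le>Suc N. scal_mult (case i of 0 \<Rightarrow> 0 | Suc m \<Rightarrow> \<sigma> (coeff q m)) (?T i))
        + (\<Sum>i\<le>Suc N. scal_mult (\<delta> (coeff q i)) (?T i))"
    by (simp only: ore_mult_upto[of _ "Suc N"] coeff_X_mult scal_add_left sum.distrib)
  also have "(\<Sum>i\<le>Suc N. scal_mult (case i of 0 \<Rightarrow> 0 | Suc m \<Rightarrow> \<sigma> (coeff q m)) (?T i))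
      = (\<Sum>i\<le>N. scal_mult (\<sigma> (coeff q i)) (?T (Suc i)))"
    by (subst sum.atMost_Suc_shift) (simp add: scal_0)
  also have "(\<Sum>i\<le>Suc N. scal_mult (\<delta> (coeff q i)) (?T i))
      = (\<Sum>i\<le>N. scal_mult (\<delta> (coeff q i)) (?T i))"
    by (simp add: N_def coeff_eq_0 \<delta>_zero scal_0)
  finally show ?thesis
    by (simp add: ore_mult_upto[of q N] N_def X_sum X_scal sum.distrib)
qed

private lemma ore_X_pow:
  "ore_mult \<sigma> \<delta> ((X_mult \<sigma> \<delta> ^^ i) q) r = (X_mult \<sigma> \<delta> ^^ i) (ore_mult \<sigma> \<delta> q r)"
  by (induction i) (simp_all add: ore_X)

private lemma ore_assoc:
  "ore_mult \<sigma> \<delta> (ore_mult \<sigma> \<delta> p q) r = ore_mult \<sigma> \<delta> p (ore_mult \<sigma> \<delta> q r)"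
  by (simp add: ore_mult_def[of _ _ p] ore_sum_left ore_scal ore_X_pow)

private lemma ore_one_left: "ore_mult \<sigma> \<delta> [:1:] q = q"
  by (rule poly_eqI) (simp add: ore_mult_def coeff_scal_mult)

private lemma ore_one_right: "ore_mult \<sigma> \<delta> p [:1:] = p"
proof -
  have "ore_mult \<sigma> \<delta> p [:1:] = (\<Sum>i\<le>degree p. monom (coeff p i) i)"
    unfolding ore_mult_def X_pow_one
    by (intro sum.cong refl poly_eqI) (simp add: coeff_scal_mult)
  then show ?thesis
    by (simp add: poly_as_sum_of_monoms)
qed

lemma ore_ring_is_ring: "ring (ore_ring \<sigma> \<delta>)"
proof (rule ringI)
  show "abelian_group (ore_ring \<sigma> \<delta>)"
    by (rule abelian_groupI)
      (auto simp: add.assoc add.commute intro: exI[of _ "- _"] add.left_inverse)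
  show "Group.monoid (ore_ring \<sigma> \<delta>)"
    by (rule monoidI) (simp_all add: ore_assoc ore_one_left ore_one_right)
qed (simp_all add: ore_add_left ore_add_right)

lemma ore_mult_const_monom: "ore_mult \<sigma> \<delta> [:a:] (monom b n) = monom (a * b) n"
  by (rule poly_eqI) (simp add: ore_mult_def coeff_scal_mult)

lemma ore_X_power: "monom 1 1 [^]\<^bsub>ore_ring \<sigma> \<delta>\<^esub> (n::nat) = monom 1 n"
proof (induction n)
  case (Suc n)
  have "ore_mult \<sigma> \<delta> (monom 1 n) (monom 1 1) = (X_mult \<sigma> \<delta> ^^ n) (monom 1 1)"
    using ore_X_pow[of n "[:1:]" "monom 1 1"] by (simp add: X_pow_one ore_one_left)
  also have "\<dots> = (X_mult \<sigma> \<delta> ^^ Suc n) [:1:]"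
    unfolding X_pow_one[of 1, symmetric] by (simp add: funpow_swap1)
  finally have "ore_mult \<sigma> \<delta> (monom 1 n) (monom 1 1) = monom 1 (Suc n)"
    by (simp only: X_pow_one)
  with Suc show ?case by simp
qed (simp add: monom_0)

text \<open>Together with uniqueness of coefficients: the powers of \<open>X\<close> form a left basis.\<close>

lemma ore_expansion:
  "p = (\<Sum>i\<le>degree p. ore_mult \<sigma> \<delta> [:coeff p i:] (monom 1 1 [^]\<^bsub>ore_ring \<sigma> \<delta>\<^esub> i))"
  unfolding ore_X_power ore_mult_const_monom by (simp add: poly_as_sum_of_monoms)

lemma ore_commutation:
  "ore_mult \<sigma> \<delta> (monom 1 1) [:a:] = ore_mult \<sigma> \<delta> [:\<sigma> a:] (monom 1 1) + [:\<delta> a:]"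
  unfolding ore_mult_const_monom
  by (rule poly_eqI)
    (auto simp: ore_mult_def degree_monom_eq coeff_scal_mult coeff_X_mult \<sigma>_zero \<delta>_zero
      coeff_pCons split: nat.split)

end


section \<open>Left ideals, annihilators, bounds\<close>

definition left_gen :: "('r, 'm) ring_scheme \<Rightarrow> 'r \<Rightarrow> 'r set" where
  "left_gen R f = {g \<otimes>\<^bsub>R\<^esub> f |g. g \<in> carrier R}"

definition right_gen :: "('r, 'm) ring_scheme \<Rightarrow> 'r \<Rightarrow> 'r set" where
  "right_gen R f = {f \<otimes>\<^bsub>R\<^esub> g |g. g \<in> carrier R}"

text \<open>
  The left module \<open>R/I\<close>, for a left ideal \<open>I\<close>: the scalar \<open>g\<close> sends the class of \<open>x\<close> to the
  class of \<open>g x\<close>. The locale for modules in the library requires a commutative ring of scalars, so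
  only its record type is used here; the fields \<^const>\<open>mult\<close> and \<^const>\<open>one\<close> of that record play
  no role in a module.
\<close>

definition left_quot :: "('r, 'm) ring_scheme \<Rightarrow> 'r set \<Rightarrow> ('r, 'r set) module" where
  "left_quot R I =
     \<lparr>carrier = a_rcosets\<^bsub>R\<^esub> I, mult = undefined, one = undefined, zero = I, add = set_add R,
      smult = (\<lambda>g C. \<Union>x\<in>C. I +>\<^bsub>R\<^esub> (g \<otimes>\<^bsub>R\<^esub> x))\<rparr>"

lemma (in ring) left_quot_smult:
  assumes I: "additive_subgroup I R" and closed: "\<And>g x. g \<in> carrier R \<Longrightarrow> x \<in> I \<Longrightarrow> g \<otimes> x \<in> I"
    and g: "g \<in> carrier R" and x: "x \<in> carrier R"
  shows "g \<odot>\<^bsub>left_quot R I\<^esub> (I +> x) = I +> (g \<otimes> x)"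
proof -
  interpret additive_subgroup I R by (rule I)
  have "I +> (g \<otimes> y) = I +> (g \<otimes> x)" if y: "y \<in> I +> x" for y
  proof -
    obtain u where u: "u \<in> I" "y = u \<oplus> x"
      using y by (auto simp: a_r_coset_def')
    have "g \<otimes> y = g \<otimes> u \<oplus> g \<otimes> x"
      using u g x by (simp add: r_distr)
    then have "g \<otimes> y \<in> I +> (g \<otimes> x)"
      using closed[OF g u(1)] by (auto simp: a_r_coset_def')
    then show ?thesis
      using add.repr_independence[OF _ _ a_subgroup, of "g \<otimes> y" "g \<otimes> x"] g x
      by (simp add: a_r_coset_def)
  qed
  then have "(\<Union>y\<in>I +> x. I +> (g \<otimes> y)) = (\<Union>y\<in>I +> x. I +> (g \<otimes> x))"
    by (intro SUP_cong refl)
  moreover have "\<zero> \<oplus> x \<in> I +> x"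
    using zero_closed unfolding a_r_coset_def' by blast
  ultimately show ?thesis
    unfolding left_quot_def by auto
qed

definition ann :: "('r, 'm) ring_scheme \<Rightarrow> ('r, 'v, 'n) module_scheme \<Rightarrow> 'v set \<Rightarrow> 'r set" where
  "ann R M S = {g \<in> carrier R. \<forall>m\<in>S. g \<odot>\<^bsub>M\<^esub> m = \<zero>\<^bsub>M\<^esub>}"

definition twosided :: "('r, 'm) ring_scheme \<Rightarrow> 'r \<Rightarrow> bool" where
  "twosided R \<alpha> \<longleftrightarrow> \<alpha> \<in> carrier R \<and> left_gen R \<alpha> = right_gen R \<alpha>"

text \<open>Bounds and least common multiples are unique only up to units, hence predicates.\<close>

definition is_bound :: "('r, 'm) ring_scheme \<Rightarrow> 'r \<Rightarrow> 'r \<Rightarrow> bool" where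
  "is_bound R f b \<longleftrightarrow> twosided R b \<and>
     ideal (left_gen R b) R \<and> left_gen R b \<subseteq> left_gen R f \<and>
     (\<forall>I. ideal I R \<and> I \<subseteq> left_gen R f \<longrightarrow> I \<subseteq> left_gen R b)"

definition is_left_lcm :: "('r, 'm) ring_scheme \<Rightarrow> 'r set \<Rightarrow> 'r \<Rightarrow> bool" where
  "is_left_lcm R A h \<longleftrightarrow> h \<in> carrier R \<and> left_gen R h = (\<Inter>g\<in>A. left_gen R g)"

definition center :: "('r, 'm) ring_scheme \<Rightarrow> 'r set" where
  "center R = {z \<in> carrier R. \<forall>g\<in>carrier R. z \<otimes>\<^bsub>R\<^esub> g = g \<otimes>\<^bsub>R\<^esub> z}"

definition generates_over_center ::
  "('r, 'm) ring_scheme \<Rightarrow> 'i set \<Rightarrow> ('i \<Rightarrow> 'r) \<Rightarrow> bool" where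
  "generates_over_center R J c \<longleftrightarrow> (\<forall>i\<in>J. c i \<in> carrier R) \<and>
     (\<forall>g\<in>carrier R. \<exists>z. (\<forall>i\<in>J. z i \<in> center R) \<and>
        g = (\<Oplus>\<^bsub>R\<^esub>i\<in>J. z i \<otimes>\<^bsub>R\<^esub> c i))"

end

theory Submission
  imports Defs
begin

text \<open>
  By centrality of the coefficients, \<open>g R \<subseteq> R f\<close> holds as soon as \<open>g c\<^sub>i \<in> R f\<close> for all \<open>i\<close>. Hence
  the intersection of \<open>R f\<close> with the annihilators of the \<open>c\<^sub>i + R f\<close> is \<open>{g. g R \<subseteq> R f}\<close>, the largest
  twosided ideal inside \<open>R f\<close>. It has a generator \<open>h\<close> as a left ideal. That \<open>R h = h R\<close>, and not
  merely \<open>h R \<subseteq> R h\<close>, is where surjectivity of \<open>\<sigma>\<close> enters: the leading term of any \<open>g h\<close> is that of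
  some \<open>h q\<close>, and \<open>h q \<in> R h\<close>, so one can induct on the degree of \<open>g\<close>.
\<close>

section \<open>Left ideals in a ring\<close>

context ring
begin

lemma left_gen_subset: "f \<in> carrier R \<Longrightarrow> left_gen R f \<subseteq> carrier R"
  by (auto simp: left_gen_def)

lemma left_gen_self: "f \<in> carrier R \<Longrightarrow> f \<in> left_gen R f"
  unfolding left_gen_def using l_one[of f] one_closed by (metis (mono_tags, lifting) mem_Collect_eq)

lemma left_gen_mult:
  assumes "f \<in> carrier R" "g \<in> carrier R" "x \<in> left_gen R f"
  shows "g \<otimes> x \<in> left_gen R f"
proof -
  obtain y where "y \<in> carrier R" "x = y \<otimes> f"
    using assms(3) by (auto simp: left_gen_def)
  then have "g \<otimes> y \<in> carrier R" "g \<otimes> x = (g \<otimes> y) \<otimes> f"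
    using assms by (auto simp: m_assoc)
  then show ?thesis
    unfolding left_gen_def by blast
qed

lemma left_gen_additive_subgroup:
  assumes f: "f \<in> carrier R"
  shows "additive_subgroup (left_gen R f) R"
proof (rule additive_subgroup.intro, rule add.subgroupI)
  show "left_gen R f \<subseteq> carrier R"
    by (rule left_gen_subset[OF f])
  show "left_gen R f \<noteq> {}"
    using left_gen_self[OF f] by blast
next
  fix x assume "x \<in> left_gen R f"
  then obtain a where "a \<in> carrier R" "x = a \<otimes> f"
    by (auto simp: left_gen_def)
  then have "\<ominus> a \<in> carrier R" "\<ominus> x = (\<ominus> a) \<otimes> f"
    using f by (auto simp: l_minus)
  then show "\<ominus> x \<in> left_gen R f"
    unfolding left_gen_def by blast
next
  fix x y assume "x \<in> left_gen R f" "y \<in> left_gen R f"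
  then obtain a b where "a \<in> carrier R" "x = a \<otimes> f" "b \<in> carrier R" "y = b \<otimes> f"
    by (auto simp: left_gen_def)
  then have "a \<oplus> b \<in> carrier R" "x \<oplus> y = (a \<oplus> b) \<otimes> f"
    using f by (auto simp: l_distr)
  then show "x \<oplus> y \<in> left_gen R f"
    unfolding left_gen_def by blast
qed

text \<open>A coset \<open>I +> x\<close> is the zero of the quotient exactly when \<open>x\<close>
  lies in \<open>I\<close>, so annihilating the class of \<open>c\<close> becomes a membership
  condition on \<open>g \<otimes> c\<close>.\<close>

lemma ann_left_quot_coset:
  assumes I: "additive_subgroup I R"
    and closed: "\<And>g x. g \<in> carrier R \<Longrightarrow> x \<in> I \<Longrightarrow> g \<otimes> x \<in> I"
    and c: "c \<in> carrier R"
  shows "ann R (left_quot R I) {I +> c} = {g \<in> carrier R. g \<otimes> c \<in> I}"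
proof -
  have "I +> x = I \<longleftrightarrow> x \<in> I" if x: "x \<in> carrier R" for x
  proof
    have "\<zero> \<oplus> x \<in> I +> x"
      using additive_subgroup.zero_closed[OF I] unfolding a_r_coset_def' by blast
    then show "x \<in> I" if "I +> x = I"
      using that x by simp
    show "I +> x = I" if "x \<in> I"
      using add.coset_join2[OF x additive_subgroup.a_subgroup[OF I] that]
      by (simp add: a_r_coset_def)
  qed
  moreover have "\<zero>\<^bsub>left_quot R I\<^esub> = I"
    by (simp add: left_quot_def)
  ultimately show ?thesis
    using c by (simp add: ann_def left_quot_smult[OF I closed] cong: conj_cong)
qed

text \<open>For central \<open>z i\<close>, the product
  \<open>g \<otimes> (z i \<otimes> c i)\<close> equals
  \<open>z i \<otimes> (g \<otimes> c i)\<close>, and the latter lies in \<open>I\<close> because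
  \<open>I\<close> absorbs multiplication from the left.\<close>

lemma left_colon_generators:
  assumes gen: "generates_over_center R J c" and J: "finite J"
    and I: "additive_subgroup I R"
    and closed: "\<And>g x. g \<in> carrier R \<Longrightarrow> x \<in> I \<Longrightarrow> g \<otimes> x \<in> I"
    and g: "g \<in> carrier R" and gc: "\<And>i. i \<in> J \<Longrightarrow> g \<otimes> c i \<in> I"
    and x: "x \<in> carrier R"
  shows "g \<otimes> x \<in> I"
proof -
  have c: "c i \<in> carrier R" if "i \<in> J" for i
    using gen that by (auto simp: generates_over_center_def)
  obtain z where z: "\<And>i. i \<in> J \<Longrightarrow> z i \<in> center R" and xz: "x = (\<Oplus>i\<in>J. z i \<otimes> c i)"
    using gen x unfolding generates_over_center_def by blast
  have zc: "z i \<in> carrier R" if "i \<in> J" for i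
    using z[OF that] by (auto simp: center_def)
  \<comment> \<open>The induction runs over subsets of \<open>J\<close>, so that centrality and
    \<open>gc\<close> stay available for each inserted index.\<close>
  have "(\<Oplus>i\<in>K. g \<otimes> (z i \<otimes> c i)) \<in> I" if "K \<subseteq> J" for K
    using finite_subset[OF that J] that
  proof (induction K rule: finite_induct)
    case empty
    then show ?case using additive_subgroup.zero_closed[OF I] by simp
  next
    case (insert i K)
    have "(g \<otimes> z i) \<otimes> c i = (z i \<otimes> g) \<otimes> c i"
      using insert.prems z[of i] zc[of i] c[of i] g
      by (simp add: center_def)
    then have "g \<otimes> (z i \<otimes> c i) \<in> I"
      using insert.prems g zc[of i] c[of i] gc[of i] closed[of "z i"] by (simp add: m_assoc)
    moreover have "(\<Oplus>i\<in>insert i K. g \<otimes> (z i \<otimes> c i))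
        = g \<otimes> (z i \<otimes> c i) \<oplus> (\<Oplus>i\<in>K. g \<otimes> (z i \<otimes> c i))"
      using insert.hyps insert.prems g zc c by (intro finsum_insert) auto
    ultimately show ?case
      using insert additive_subgroup.a_closed[OF I] by auto
  qed
  moreover have "g \<otimes> x = (\<Oplus>i\<in>J. g \<otimes> (z i \<otimes> c i))"
    unfolding xz using J g zc c by (intro finsum_rdistr) auto
  ultimately show ?thesis
    by simp
qed

text \<open>This set is the annihilator of the left module R/I. Absorption on the right comes from
  the quantifier over all \<open>x\<close>, absorption on the left from
  \<open>closed\<close>.\<close>

lemma left_colon_ideal:
  assumes I: "additive_subgroup I R"
    and closed: "\<And>g x. g \<in> carrier R \<Longrightarrow> x \<in> I \<Longrightarrow> g \<otimes> x \<in> I"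
  shows "ideal {g \<in> carrier R. \<forall>x\<in>carrier R. g \<otimes> x \<in> I} R" (is "ideal ?C R")
proof -
  interpret I: additive_subgroup I R by (rule I)
  show ?thesis
  proof (rule idealI[OF ring_axioms])
    show "subgroup ?C (add_monoid R)"
    proof (rule add.subgroupI)
      show "?C \<noteq> {}"
      proof -
        have "\<zero> \<in> ?C"
          using I.zero_closed by simp
        then show ?thesis by blast
      qed
    next
      fix a assume "a \<in> ?C"
      then show "\<ominus> a \<in> ?C"
        by (simp add: l_minus)
    next
      fix a b assume "a \<in> ?C" "b \<in> ?C"
      then show "a \<oplus> b \<in> ?C"
        by (simp add: l_distr)
    qed blast
  next
    fix a x assume "a \<in> ?C" "x \<in> carrier R"
    then show "x \<otimes> a \<in> ?C" "a \<otimes> x \<in> ?C"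
      by (simp_all add: m_assoc closed)
  qed
qed

end


section \<open>Leading coefficients in an Ore polynomial ring\<close>

context
  fixes \<sigma> \<delta> :: "'a::division_ring \<Rightarrow> 'a"
  assumes \<sigma>: "ring_automorphism \<sigma>" and \<delta>: "skew_derivation \<sigma> \<delta>"
begin

interpretation R: ring "ore_ring \<sigma> \<delta>"
  by (rule ore_ring_is_ring[OF \<sigma> \<delta>])

lemma automorphism_0: "\<sigma> 0 = 0"
  using \<sigma> unfolding ring_automorphism_def by (metis add_cancel_right_right)

lemma skew_derivation_0: "\<delta> 0 = 0"
  using \<delta> unfolding skew_derivation_def by (metis add_cancel_right_right)

lemma bij_automorphism_pow: "bij (\<sigma> ^^ n)"
  using \<sigma> by (intro bij_betw_funpow) (simp add: ring_automorphism_def)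

lemma automorphism_pow_eq_0_iff: "(\<sigma> ^^ n) a = 0 \<longleftrightarrow> a = 0"
proof -
  have "(\<sigma> ^^ n) 0 = 0"
    by (induction n) (simp_all add: automorphism_0)
  then show ?thesis
    using bij_is_inj[OF bij_automorphism_pow[of n]] by (metis injD)
qed

lemma coeff_X_mult: "coeff (X_mult \<sigma> \<delta> q) n =
    (case n of 0 \<Rightarrow> 0 | Suc m \<Rightarrow> \<sigma> (coeff q m)) + \<delta> (coeff q n)"
  by (simp add: X_mult_def coeff_map_poly automorphism_0 skew_derivation_0 coeff_pCons split: nat.split)

text \<open>The \<delta> part of a multiplication by X does not raise the degree, so the top
  position receives only the \<sigma> part. The bound \<open>n\<close> need not be the exact degree;
  the top coefficient may vanish.\<close>

lemma X_mult_pow_top: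
  assumes "degree q \<le> n"
  shows "degree ((X_mult \<sigma> \<delta> ^^ i) q) \<le> i + n \<and>
    coeff ((X_mult \<sigma> \<delta> ^^ i) q) (i + n) = (\<sigma> ^^ i) (coeff q n)"
proof (induction i)
  case 0
  then show ?case using assms by simp
next
  case (Suc i)
  let ?p = "(X_mult \<sigma> \<delta> ^^ i) q"
  have "coeff ?p k = 0" if "k > i + n" for k
    using Suc that by (intro coeff_eq_0) auto
  then have "coeff (X_mult \<sigma> \<delta> ?p) k = 0" if "k > Suc i + n" for k
    using that by (cases k) (auto simp: coeff_X_mult automorphism_0 skew_derivation_0)
  moreover have "coeff (X_mult \<sigma> \<delta> ?p) (Suc i + n) = \<sigma> (coeff ?p (i + n))"
    using \<open>\<And>k. k > i + n \<Longrightarrow> coeff ?p k = 0\<close> by (simp add: coeff_X_mult skew_derivation_0)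
  ultimately show ?case
    using Suc by (auto intro: degree_le)
qed

text \<open>Since X^i q has degree at most i + n, only the summand i = m reaches position m + n.
  Stating this with degree bounds covers zero polynomials and monomials whose coefficient may be
  zero.\<close>

lemma ore_mult_top:
  assumes p: "degree p \<le> m" and q: "degree q \<le> n"
  shows degree_ore_mult_le: "degree (ore_mult \<sigma> \<delta> p q) \<le> m + n"
    and coeff_ore_mult_top:
      "coeff (ore_mult \<sigma> \<delta> p q) (m + n) = coeff p m * (\<sigma> ^^ m) (coeff q n)"
proof -
  let ?x = "\<lambda>i k. coeff p i * coeff ((X_mult \<sigma> \<delta> ^^ i) q) k"
  have coeff: "coeff (ore_mult \<sigma> \<delta> p q) k = (\<Sum>i\<le>degree p. ?x i k)" for k
    by (simp add: ore_mult_def scal_mult_def coeff_sum coeff_map_poly)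
  have vanish: "?x i k = 0" if "i + n < k" for i k
    using X_mult_pow_top[OF q, of i] that by (simp add: coeff_eq_0)
  show "degree (ore_mult \<sigma> \<delta> p q) \<le> m + n"
    using p by (intro degree_le allI impI) (auto simp: coeff vanish intro!: sum.neutral)
  have "coeff (ore_mult \<sigma> \<delta> p q) (m + n) = (\<Sum>i\<le>m. ?x i (m + n))"
    unfolding coeff using p by (intro sum.mono_neutral_left) (auto simp: coeff_eq_0)
  also have "\<dots> = (\<Sum>i\<in>{m}. ?x i (m + n))"
    by (intro sum.mono_neutral_right) (auto simp: vanish)
  finally show "coeff (ore_mult \<sigma> \<delta> p q) (m + n) = coeff p m * (\<sigma> ^^ m) (coeff q n)"
    using X_mult_pow_top[OF q, of m] by simp
qed

lemma degree_ore_mult: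
  assumes "p \<noteq> 0" "q \<noteq> 0"
  shows "degree (ore_mult \<sigma> \<delta> p q) = degree p + degree q"
proof (rule antisym)
  show "degree (ore_mult \<sigma> \<delta> p q) \<le> degree p + degree q"
    by (rule degree_ore_mult_le) simp_all
  show "degree p + degree q \<le> degree (ore_mult \<sigma> \<delta> p q)"
    using assms by (intro le_degree)
      (simp add: coeff_ore_mult_top[OF order_refl order_refl] automorphism_pow_eq_0_iff)
qed

lemma ore_0_mult: "ore_mult \<sigma> \<delta> 0 p = 0"
  using R.l_null[of p] by simp

lemma ore_mult_0: "ore_mult \<sigma> \<delta> p 0 = 0"
  using R.r_null[of p] by simp

lemma ore_mult_add_left: "ore_mult \<sigma> \<delta> (p + q) s = ore_mult \<sigma> \<delta> p s + ore_mult \<sigma> \<delta> q s"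
  using R.l_distr[of p q s] by simp

lemma ore_mult_add_right: "ore_mult \<sigma> \<delta> s (p + q) = ore_mult \<sigma> \<delta> s p + ore_mult \<sigma> \<delta> s q"
  using R.r_distr[of p q s] by simp

lemma ore_mult_diff_left: "ore_mult \<sigma> \<delta> (p - q) s = ore_mult \<sigma> \<delta> p s - ore_mult \<sigma> \<delta> q s"
  using ore_mult_add_left[of "p - q" q s] by simp

text \<open>The case n = 0 cannot occur: both polynomials would be constants with the same
  coefficient, against \<open>p \<noteq> q\<close>.\<close>

lemma degree_less_if_top_cancels:
  fixes p q :: "'a poly"
  assumes "degree p \<le> n" "degree q \<le> n" "coeff p n = coeff q n" "p \<noteq> q"
  shows "degree (p - q) < n"
proof -
  have "degree (p - q) \<le> n" "coeff (p - q) n = 0"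
    using assms by (auto intro: degree_diff_le)
  moreover have "coeff (p - q) (degree (p - q)) \<noteq> 0"
    unfolding leading_coeff_0_iff using assms(4) by simp
  ultimately show ?thesis
    using le_neq_implies_less by metis
qed

section \<open>Principal and twosided ideals of an Ore polynomial ring\<close>

text \<open>Division with remainder by a nonzero element of least degree, with quotients on the
  left; one induction step removes one leading term.\<close>

lemma left_ideal_principal:
  assumes "additive_subgroup I (ore_ring \<sigma> \<delta>)"
    and closed: "\<And>g x. x \<in> I \<Longrightarrow> ore_mult \<sigma> \<delta> g x \<in> I"
  shows "\<exists>h. left_gen (ore_ring \<sigma> \<delta>) h = I"
proof (cases "I \<subseteq> {0}")
  case True
  interpret additive_subgroup I "ore_ring \<sigma> \<delta>" by fact
  have "left_gen (ore_ring \<sigma> \<delta>) 0 = I"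
    using True zero_closed by (auto simp: left_gen_def ore_mult_0)
  then show ?thesis by blast
next
  case False
  interpret additive_subgroup I "ore_ring \<sigma> \<delta>" by fact
  have diff: "p - q \<in> I" if "p \<in> I" "q \<in> I" for p q
  proof -
    have "\<ominus>\<^bsub>ore_ring \<sigma> \<delta>\<^esub> q = - q"
      by (rule R.minus_equality) simp_all
    then show ?thesis
      using a_closed[OF that(1) a_inv_closed[OF that(2)]] by simp
  qed
  obtain h where h: "h \<in> I" "h \<noteq> 0" and min: "\<And>p. p \<in> I \<Longrightarrow> p \<noteq> 0 \<Longrightarrow> degree h \<le> degree p"
  proof -
    obtain p where "p \<in> I \<and> p \<noteq> 0"
      using False by blast
    from ex_has_least_nat[of "\<lambda>p. p \<in> I \<and> p \<noteq> 0", OF this, of degree]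
    show ?thesis using that by blast
  qed
  have "\<exists>g. p = ore_mult \<sigma> \<delta> g h" if "p \<in> I" for p
    using that
  proof (induction "degree p" arbitrary: p rule: less_induct)
    case less
    show ?case
    proof (cases "p = 0")
      case True
      then show ?thesis using ore_0_mult[of h] by metis
    next
      case False
      \<comment> \<open>Moving X^k past the leading coefficient of \<open>h\<close> twists it by
        \<open>\<sigma> ^^ k\<close>. Dividing by the twisted value \<open>l\<close> therefore gives
        \<open>t\<close> times \<open>h\<close> the leading term of \<open>p\<close>.\<close>
      define k where "k = degree p - degree h"
      define l where "l = (\<sigma> ^^ k) (lead_coeff h)"
      define t where "t = monom (lead_coeff p / l) k"
      have deg: "degree p = k + degree h"
        using min[OF less.prems False] by (simp add: k_def)
      have t: "degree t \<le> k"
        by (simp add: t_def degree_monom_le)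
      have "l \<noteq> 0"
        using h by (simp add: l_def automorphism_pow_eq_0_iff)
      then have "coeff t k * l = lead_coeff p"
        by (simp add: t_def divide_inverse mult.assoc)
      then have "coeff (ore_mult \<sigma> \<delta> t h) (degree p) = lead_coeff p"
        using coeff_ore_mult_top[OF t order_refl, of h] unfolding deg[symmetric] l_def by simp
      \<comment> \<open>The zero difference is kept apart: it has degree 0, which is not a decrease
        when \<open>p\<close> is constant.\<close>
      then have "p - ore_mult \<sigma> \<delta> t h = 0 \<or> degree (p - ore_mult \<sigma> \<delta> t h) < degree p"
        using degree_less_if_top_cancels[of p "degree p" "ore_mult \<sigma> \<delta> t h"]
          degree_ore_mult_le[OF t order_refl, of h] unfolding deg[symmetric] by auto
      moreover have "p - ore_mult \<sigma> \<delta> t h \<in> I"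
        using less.prems closed[OF h(1)] diff by blast
      ultimately obtain g where "p - ore_mult \<sigma> \<delta> t h = ore_mult \<sigma> \<delta> g h"
        using less.hyps ore_0_mult[of h] by metis
      then have "p = ore_mult \<sigma> \<delta> (g + t) h"
        by (simp add: ore_mult_add_left algebra_simps)
      then show ?thesis by blast
    qed
  qed
  then have "left_gen (ore_ring \<sigma> \<delta>) h = I"
    using closed[OF h(1)] by (auto simp: left_gen_def)
  then show ?thesis by blast
qed

lemma twosided_if_ideal:
  assumes "ideal (left_gen (ore_ring \<sigma> \<delta>) h) (ore_ring \<sigma> \<delta>)"
  shows "twosided (ore_ring \<sigma> \<delta>) h"
proof -
  interpret ideal "left_gen (ore_ring \<sigma> \<delta>) h" "ore_ring \<sigma> \<delta>" by fact
  \<comment> \<open>Closure under right multiplication gives h R inside R h; the reverse inclusion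
    remains.\<close>
  have hR: "\<exists>g. ore_mult \<sigma> \<delta> h q = ore_mult \<sigma> \<delta> g h" for q
    using I_r_closed[OF R.left_gen_self, of q] by (auto simp: left_gen_def)
  have "\<exists>q. ore_mult \<sigma> \<delta> g h = ore_mult \<sigma> \<delta> h q" for g
  proof (cases "h = 0")
    case True
    then show ?thesis by (simp add: ore_0_mult ore_mult_0)
  next
    case h: False
    show ?thesis
    proof (induction "degree g" arbitrary: g rule: less_induct)
      case less
      let ?m = "degree h" and ?n = "degree g"
      \<comment> \<open>The equation says that h b X^n and g h have the same coefficient in degree m
        + n. It is solvable because \<open>\<sigma> ^^ ?m\<close> is surjective and the leading
        coefficient of \<open>h\<close> is invertible.\<close>
      obtain b where b: "(\<sigma> ^^ ?m) b = inverse (lead_coeff h) * (lead_coeff g * (\<sigma> ^^ ?n) (lead_coeff h))"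
        using bij_is_surj[OF bij_automorphism_pow[of ?m]] by (metis surjD)
      define t where "t = monom b ?n"
      have t: "degree t \<le> ?n"
        by (simp add: t_def degree_monom_le)
      \<comment> \<open>Writing h t as a left multiple of \<open>h\<close> makes it comparable with
        g h: cancelling the twisted leading coefficient of \<open>h\<close> on the right shows that
        \<open>g'\<close> and \<open>g\<close> agree in degree n. The induction hypothesis then
        handles g - g'.\<close>
      obtain g' where g': "ore_mult \<sigma> \<delta> h t = ore_mult \<sigma> \<delta> g' h"
        using hR by blast
      have deg: "degree g' \<le> ?n"
      proof (cases "g' = 0")
        case False
        then have "degree g' + ?m \<le> ?m + ?n"
          using degree_ore_mult[OF False h] degree_ore_mult_le[OF order_refl t, of h] g' by simp
        then show ?thesis by simp
      qed simp
      have "coeff g' ?n * (\<sigma> ^^ ?n) (lead_coeff h) = coeff (ore_mult \<sigma> \<delta> g' h) (?n + ?m)"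
        by (rule coeff_ore_mult_top[OF deg order_refl, symmetric])
      also have "\<dots> = coeff (ore_mult \<sigma> \<delta> h t) (?m + ?n)"
        by (simp add: g' add.commute)
      also have "\<dots> = lead_coeff g * (\<sigma> ^^ ?n) (lead_coeff h)"
        unfolding coeff_ore_mult_top[OF order_refl t] using h
        by (simp add: t_def b flip: mult.assoc)
      finally have "coeff g' ?n = lead_coeff g"
        using h by (simp add: automorphism_pow_eq_0_iff)
      then have "g - g' = 0 \<or> degree (g - g') < degree g"
        using degree_less_if_top_cancels[of g ?n g'] deg by auto
      then obtain q where "ore_mult \<sigma> \<delta> (g - g') h = ore_mult \<sigma> \<delta> h q"
        using less.hyps ore_0_mult[of h] ore_mult_0[of h] by metis
      then have "ore_mult \<sigma> \<delta> g h = ore_mult \<sigma> \<delta> h (q + t)"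
        by (simp add: ore_mult_diff_left ore_mult_add_right g' algebra_simps)
      then show ?case by blast
    qed
  qed
  then show ?thesis
    using hR by (auto simp: twosided_def left_gen_def right_gen_def)
qed

end

text \<open>The existence conjunct keeps the second one from being vacuous. The second covers every
  choice of the least common multiple, which is determined only up to units.\<close>

theorem proposition2p4:
  fixes \<sigma> \<delta> :: "'a::division_ring \<Rightarrow> 'a"
    and R :: "'a poly ring"
    and r :: nat
    and c fc :: "nat \<Rightarrow> 'a poly"
    and f :: "'a poly"
  assumes "ring_automorphism \<sigma>"
    and "skew_derivation \<sigma> \<delta>"
    and R: "R = ore_ring \<sigma> \<delta>"
    and "generates_over_center R {1..r} c"
    and "f \<noteq> \<zero>\<^bsub>R\<^esub>"
    and "\<And>i. i \<in> {1..r} \<Longrightarrow>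
           left_gen R (fc i) =
             ann R (left_quot R (left_gen R f)) {left_gen R f +>\<^bsub>R\<^esub> c i}"
  shows "(\<exists>h. is_left_lcm R (insert f (fc ` {1..r})) h) \<and>
         (\<forall>h. is_left_lcm R (insert f (fc ` {1..r})) h \<longrightarrow> is_bound R f h)"
proof -
  interpret ring R
    unfolding R by (rule ore_ring_is_ring[OF assms(1,2)])
  have carrier: "x \<in> carrier R" for x
    by (simp add: R)
  let ?I = "left_gen R f"
  \<comment> \<open>This is the annihilator of R/Rf. Both the least common multiples and the bounds
    of \<open>f\<close> are recognized as the generators of this left ideal.\<close>
  define C where "C = {g \<in> carrier R. \<forall>x\<in>carrier R. g \<otimes>\<^bsub>R\<^esub> x \<in> ?I}"
  have sub: "additive_subgroup ?I R"
    by (rule left_gen_additive_subgroup[OF carrier])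
  have closed: "g \<otimes>\<^bsub>R\<^esub> x \<in> ?I" if "x \<in> ?I" for g x
    by (rule left_gen_mult[OF carrier carrier that])
  have C: "ideal C R"
    unfolding C_def by (rule left_colon_ideal[OF sub closed])
  have C_le: "C \<subseteq> ?I"
  proof
    fix g assume "g \<in> C"
    then have "g \<otimes>\<^bsub>R\<^esub> \<one>\<^bsub>R\<^esub> \<in> ?I"
      unfolding C_def using one_closed by blast
    then show "g \<in> ?I"
      using r_one[OF carrier] by simp
  qed
  have "left_gen R (fc i) = {g. g \<otimes>\<^bsub>R\<^esub> c i \<in> ?I}" if "i \<in> {1..r}" for i
    using assms(6)[OF that] ann_left_quot_coset[OF sub closed carrier] carrier by simp
  then have "(\<Inter>g\<in>insert f (fc ` {1..r}). left_gen R g)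
      = ?I \<inter> {g. \<forall>i\<in>{1..r}. g \<otimes>\<^bsub>R\<^esub> c i \<in> ?I}"
    by auto
  \<comment> \<open>Membership in \<open>C\<close> follows from the conditions on the generators by
    centrality; conversely, each such condition is the case x = \<open>c i\<close>.\<close>
  also have "\<dots> = C"
    using left_colon_generators[OF assms(4) _ sub closed] C_le carrier
    by (auto simp: C_def)
  finally have lcm_iff: "is_left_lcm R (insert f (fc ` {1..r})) h \<longleftrightarrow> left_gen R h = C" for h
    by (simp add: is_left_lcm_def carrier)
  have "\<exists>h. left_gen R h = C"
    unfolding R
  proof (rule left_ideal_principal[OF assms(1,2)])
    show "additive_subgroup C (ore_ring \<sigma> \<delta>)"
      using ideal.axioms(1)[OF C] by (simp add: R)
    show "ore_mult \<sigma> \<delta> g x \<in> C" if "x \<in> C" for g x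
      using ideal.I_l_closed[OF C that carrier, of g] by (simp add: R)
  qed
  moreover have "is_bound R f h" if h: "left_gen R h = C" for h
  proof -
    have "twosided R h"
      using twosided_if_ideal[OF assms(1,2), of h] C h by (simp add: R)
    \<comment> \<open>For g in \<open>J\<close>, every product g x stays in \<open>J\<close> and
      hence in Rf, which is the condition defining \<open>C\<close>.\<close>
    moreover have "J \<subseteq> C" if "ideal J R" "J \<subseteq> ?I" for J
      using that ideal.I_r_closed[OF that(1)] carrier by (auto simp: C_def)
    ultimately show ?thesis
      using C C_le by (simp add: is_bound_def h)
  qed
  ultimately show ?thesis
    unfolding lcm_iff by blast
qed

end
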